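(* Let $M\in\mathbb{R}^{n\times n}$ be symmetric positive definite. Consider iteration $k$ of the exact linesearch method (described in the context) applied to the minimization of $\frac12 x^THx+c^Tx$ with $H=H^T\succ0$, where $1\le k<r$. Assume that $p_i=\delta_i p_i^{PCG}$ with $\delta_i\ne 0$ for $i=0,\dots,k-1$, where $p_i^{PCG}$ are the search directions of the preconditioned method of conjugate gradients with preconditioning matrix $M$. Let $$A_k = I-\frac{1}{g_{k-1}^T p_{k-1}}\, p_{k-1} g_k^T .$$ Then $A_k$ is nonsingular with $$A_k^{-1} = I+\frac{1}{g_{k-1}^T p_{k-1}}\, p_{k-1} g_k^T,$$ and $MA_k p_k^{PCG}=-g_k$. In addition, if $p_k$ is given by $B_k p_k=-g_k$ with $B_k\in\mathbb{R}^{n\times n}$ nonsingular, then, for any nonzero scalar $\delta_k$, it holds that $p_k=\delta_k p_k^{PCG}$ if and only if $$B_k A_k^{-1}M^{-1} g_k=\frac1{\delta_k} g_k,$$ or equivalently if and only if $$B_k=A_k^T W_k A_k \quad\text{for some nonsingular } W_k \text{ with } W_kM^{-1} g_k=\frac1{\delta_k} g_k.$$ Finally, for $B_k=A_k^TW_kA_k$, it holds that $B_k\succ0$ if and only if $W_k\succ 0$.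
   Context: Let $H\in\mathbb{R}^{n\times n}$ with $H=H^T\succ0$ and $c\in\mathbb{R}^n$. For a square real matrix $X$, $X\succ0$ means $x^TXx>0$ for all $x\neq0$. Exact linesearch method: given $x_0\in\mathbb{R}^n$, set $g_0=Hx_0+c$; for $k=0,1,\dots$, as long as $g_k\ne0$, choose a search direction $p_k$ and set $$\theta_k=-\frac{g_k^Tp_k}{p_k^THp_k},\quad x_{k+1}=x_k+\theta_kp_k,\quad g_{k+1}=g_k+\theta_kHp_k .$$ The index $r$ denotes the iteration at which the method terminates, i.e. the first index with $g_r=0$; so $k<r$ means $g_0,\dots,g_k$ are all nonzero. The preconditioned method of conjugate gradients (PCG) with symmetric positive definite preconditioning matrix $M$ is the exact linesearch method with search directions $p_0^{PCG}=-M^{-1}g_0$ and $p_k^{PCG}=-M^{-1}g_k+\frac{g_k^TM^{-1}g_k}{g_{k-1}^TM^{-1}g_{k-1}}p_{k-1}^{PCG}$ for $k\ge1$. PCG and the method under consideration are started from the same $x_0$; when $p_i=\delta_ip_i^{PCG}$ with $\delta_i\neq0$ for $i=0,\dots,k-1$, the iterates $x_i$ and gradients $g_i$, $i=0,\dots,k$, of the two methods coincide. *)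

theory Defs
  imports "HOL-Analysis.Analysis"
begin

text \<open>Symmetry is deliberately not part of \<open>pos_def\<close>; it is a separate hypothesis where needed.\<close>

definition pos_def :: "real^'n^'n \<Rightarrow> bool" where
  "pos_def X \<longleftrightarrow> (\<forall>x. x \<noteq> 0 \<longrightarrow> x \<bullet> (X *v x) > 0)"

definition outer :: "real^'n \<Rightarrow> real^'n \<Rightarrow> real^'n^'n" where
  "outer u v = (\<chi> i j. u $ i * v $ j)"

text \<open>
  A run of the exact linesearch method on \<open>(1/2) x\<^sup>T H x + c\<^sup>T x\<close>, with iterates \<open>x\<close>, gradients \<open>g\<close>
  and search directions \<open>p\<close>. The values of the sequences are constrained only until the first
  zero gradient, where the method terminates.
\<close>

definition exact_linesearch ::
  "real^'n^'n \<Rightarrow> real^'n \<Rightarrow> (nat \<Rightarrow> real^'n) \<Rightarrow> (nat \<Rightarrow> real^'n) \<Rightarrow> (nat \<Rightarrow> real^'n) \<Rightarrow> bool" where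
  "exact_linesearch H c x g p \<longleftrightarrow>
     g 0 = H *v x 0 + c \<and>
     (\<forall>k. (\<forall>i\<le>k. g i \<noteq> 0) \<longrightarrow>
        (let \<theta> = - (g k \<bullet> p k) / (p k \<bullet> (H *v p k)) in
           x (Suc k) = x k + \<theta> *\<^sub>R p k \<and>
           g (Suc k) = g k + \<theta> *\<^sub>R (H *v p k)))"

definition pcg ::
  "real^'n^'n \<Rightarrow> real^'n^'n \<Rightarrow> real^'n \<Rightarrow>
     (nat \<Rightarrow> real^'n) \<Rightarrow> (nat \<Rightarrow> real^'n) \<Rightarrow> (nat \<Rightarrow> real^'n) \<Rightarrow> bool" where
  "pcg M H c x g p \<longleftrightarrow>
     exact_linesearch H c x g p \<and>
     (g 0 \<noteq> 0 \<longrightarrow> p 0 = - (matrix_inv M *v g 0)) \<and>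
     (\<forall>k. (\<forall>i\<le>Suc k. g i \<noteq> 0) \<longrightarrow>
        p (Suc k) = - (matrix_inv M *v g (Suc k))
          + ((g (Suc k) \<bullet> (matrix_inv M *v g (Suc k))) / (g k \<bullet> (matrix_inv M *v g k))) *\<^sub>R p k)"

end

theory Submission imports Defs begin

text \<open>
  Exact linesearch makes \<open>g\<^sub>k\<close> orthogonal to \<open>p\<^sub>k\<^sub>-\<^sub>1\<close>, so the rank-one part of \<open>A\<^sub>k\<close> squares to zero and
  \<open>A\<^sub>k\<^sup>T g\<^sub>k = g\<^sub>k\<close>. Since also \<open>g\<^sub>k\<^sub>-\<^sub>1\<^sup>T p\<^sub>k\<^sub>-\<^sub>1\<^sup>P\<^sup>C\<^sup>G = - g\<^sub>k\<^sub>-\<^sub>1\<^sup>T M\<^sup>-\<^sup>1 g\<^sub>k\<^sub>-\<^sub>1\<close>, the PCG recursion reads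
  \<open>A\<^sub>k p\<^sub>k\<^sup>P\<^sup>C\<^sup>G = - M\<^sup>-\<^sup>1 g\<^sub>k\<close>, and the characterisations of \<open>B\<^sub>k\<close> follow by
  multiplying with \<open>B\<^sub>k\<close> and \<open>A\<^sub>k\<^sup>-\<^sup>T\<close>.
\<close>

lemma outer_mult_vec: "outer u v *v w = (v \<bullet> w) *\<^sub>R u"
  by (simp add: vec_eq_iff outer_def matrix_vector_mult_def inner_vec_def sum_distrib_left
      sum_distrib_right mult_ac)

lemma inner_matrix_vector_transpose:
  fixes A :: "real^'n^'m"
  shows "x \<bullet> (transpose A *v y) = (A *v x) \<bullet> y"
  by (metis dot_lmul_matrix transpose_matrix_vector inner_commute)

lemma matrix_vector_mult_minus_right:
  fixes A :: "real^'n^'m"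
  shows "A *v (- x) = - (A *v x)"
  using matrix_vector_mult_scaleR[of A "-1" x] by simp

lemma id_plus_outer_mult_vec:
  "(mat 1 + t *\<^sub>R outer u v) *v w = w + (t * (v \<bullet> w)) *\<^sub>R u"
  by (simp add: matrix_vector_mult_add_rdistrib outer_mult_vec flip: scaleR_matrix_vector_assoc)

lemma id_minus_outer_mult_vec:
  "(mat 1 - t *\<^sub>R outer u v) *v w = w - (t * (v \<bullet> w)) *\<^sub>R u"
  using id_plus_outer_mult_vec[of "- t"] by simp

lemma matrix_inv_mult:
  fixes A :: "real^'n^'n"
  assumes "invertible A"
  shows "A ** matrix_inv A = mat 1" and "matrix_inv A ** A = mat 1"
  using someI_ex[OF assms[unfolded invertible_def]] by (simp_all add: matrix_inv_def)

lemma matrix_inv_eqI: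
  fixes A B :: "real^'n^'n"
  assumes "A ** B = mat 1"
  shows "invertible A" and "matrix_inv A = B"
proof -
  show inv: "invertible A"
    using assms by (auto simp: invertible_right_inverse)
  show "matrix_inv A = B"
    by (metis assms inv matrix_inv_mult(2) matrix_mul_assoc matrix_mul_lid matrix_mul_rid)
qed

text \<open>Squaring \<open>outer u v\<close> only multiplies it by \<open>v \<bullet> u\<close>, so
  here it is nilpotent and the difference of squares collapses to the identity.\<close>

lemma inverse_id_minus_outer:
  fixes u v :: "real^'n"
  assumes "v \<bullet> u = 0"
  shows "invertible (mat 1 - t *\<^sub>R outer u v)"
    and "matrix_inv (mat 1 - t *\<^sub>R outer u v) = mat 1 + t *\<^sub>R outer u v"
proof -
  have "(mat 1 - t *\<^sub>R outer u v) ** (mat 1 + t *\<^sub>R outer u v) = mat 1"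
    using assms
    by (simp add: matrix_eq id_plus_outer_mult_vec id_minus_outer_mult_vec inner_add_right
        flip: matrix_vector_mul_assoc)
  then show "invertible (mat 1 - t *\<^sub>R outer u v)"
    and "matrix_inv (mat 1 - t *\<^sub>R outer u v) = mat 1 + t *\<^sub>R outer u v"
    by (rule matrix_inv_eqI)+
qed

lemma matrix_inv_vec_cancel:
  fixes A :: "real^'n^'n"
  assumes "invertible A"
  shows "A *v (matrix_inv A *v w) = w" and "matrix_inv A *v (A *v w) = w"
  using assms by (simp_all add: matrix_vector_mul_assoc matrix_inv_mult)

lemma pos_def_imp_invertible:
  assumes "pos_def M"
  shows "invertible M"
proof -
  have "x = 0" if "M *v x = 0" for x
    using assms that by (force simp: pos_def_def)
  then show ?thesis
    by (simp add: invertible_left_inverse matrix_left_invertible_ker)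
qed

text \<open>The substitution x = M y turns the quadratic form of the inverse at x into that of M at
  y, so symmetry does not enter.\<close>

lemma pos_def_matrix_inv:
  fixes M :: "real^'n^'n"
  assumes "pos_def M"
  shows "pos_def (matrix_inv M)"
  unfolding pos_def_def
proof (intro allI impI)
  fix x :: "real^'n"
  assume "x \<noteq> 0"
  define y where "y = matrix_inv M *v x"
  have x: "x = M *v y"
    using assms by (simp add: y_def matrix_inv_vec_cancel pos_def_imp_invertible)
  with \<open>x \<noteq> 0\<close> have "y \<noteq> 0" by auto
  with assms have "y \<bullet> (M *v y) > 0" by (simp add: pos_def_def)
  then show "x \<bullet> (matrix_inv M *v x) > 0"
    by (simp add: inner_commute flip: y_def x)
qed

text \<open>The form of the congruent matrix at x is the form of \<open>W\<close> at
  \<open>A *v x\<close>, and \<open>A\<close> permutes the nonzero vectors.\<close>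

lemma pos_def_congruence:
  fixes A W :: "real^'n^'n"
  assumes "invertible A"
  shows "pos_def (transpose A ** W ** A) \<longleftrightarrow> pos_def W"
proof -
  have quad: "x \<bullet> ((transpose A ** W ** A) *v x) = (A *v x) \<bullet> (W *v (A *v x))" for x
    by (simp add: inner_matrix_vector_transpose del: transpose_matrix_vector flip: matrix_vector_mul_assoc)
  have nz: "A *v x \<noteq> 0 \<longleftrightarrow> x \<noteq> 0" for x
    using matrix_inv_vec_cancel(2)[OF assms, of x] by auto
  have surj: "\<exists>x. y = A *v x" for y
    using matrix_inv_vec_cancel(1)[OF assms, of y] by metis
  show ?thesis
    unfolding pos_def_def quad using nz surj by metis
qed

lemma exact_linesearch_step:
  assumes "exact_linesearch H c x g p" and "\<forall>i\<le>k. g i \<noteq> 0"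
  shows "g (Suc k) = g k + (- (g k \<bullet> p k) / (p k \<bullet> (H *v p k))) *\<^sub>R (H *v p k)"
  using assms by (simp add: exact_linesearch_def Let_def)

text \<open>The step length is the zero of the directional derivative along \<open>p k\<close>.
  Positive definiteness keeps its denominator nonzero unless \<open>p k = 0\<close>, where the claim
  is trivial.\<close>

lemma exact_linesearch_orthogonal:
  assumes "pos_def H" and "exact_linesearch H c x g p" and "\<forall>i\<le>k. g i \<noteq> 0"
  shows "g (Suc k) \<bullet> p k = 0"
proof (cases "p k = 0")
  case False
  with assms(1) have "p k \<bullet> (H *v p k) \<noteq> 0"
    by (force simp: pos_def_def)
  then show ?thesis
    by (simp add: exact_linesearch_step[OF assms(2,3)] inner_diff_left inner_commute[of "H *v p k"])
qed simp

text \<open>The exact step is invariant under rescaling the search direction.\<close>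

lemma exact_linesearch_gradients_eq:
  fixes g g' :: "nat \<Rightarrow> real^'n"
  assumes run: "exact_linesearch H c x g p" and run': "exact_linesearch H c x' g' p'"
    and start: "x' 0 = x 0"
    and parallel: "\<forall>i<k. \<delta> i \<noteq> 0 \<and> p i = \<delta> i *\<^sub>R p' i"
    and nz: "\<forall>i<k. g i \<noteq> 0" and "j \<le> k"
  shows "g' j = g j"
  using \<open>j \<le> k\<close>
proof (induction j rule: less_induct)
  case (less j)
  show ?case
  proof (cases j)
    case 0
    with run run' start show ?thesis by (simp add: exact_linesearch_def)
  next
    case (Suc m)
    have eq: "g' i = g i" if "i \<le> m" for i
      using less Suc that by simp
    have g_nz: "\<forall>i\<le>m. g i \<noteq> 0" using nz less.prems Suc by simp
    \<comment> \<open>Nonvanishing has to be carried over, since the update of the second run is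
      only specified before its termination.\<close>
    then have g'_nz: "\<forall>i\<le>m. g' i \<noteq> 0" using eq by simp
    have "\<delta> m \<noteq> 0" "p m = \<delta> m *\<^sub>R p' m" using parallel less.prems Suc by auto
    \<comment> \<open>Scaling the direction by \<open>\<delta> m\<close> divides the step length by
      \<open>\<delta> m\<close>, so the increment of the gradient is unchanged.\<close>
    then show ?thesis
      unfolding Suc exact_linesearch_step[OF run g_nz] exact_linesearch_step[OF run' g'_nz]
      by (simp add: eq matrix_vector_mult_scaleR)
  qed
qed

text \<open>The multiple of the previous direction in the recursion is orthogonal to the current
  gradient, so only the preconditioned gradient contributes.\<close>

lemma pcg_gradient_inner_direction:
  assumes "pos_def H" and "pcg M H c x g p" and nz: "\<forall>i\<le>k. g i \<noteq> 0"
  shows "g k \<bullet> p k = - (g k \<bullet> (matrix_inv M *v g k))"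
proof (cases k)
  case 0
  with assms show ?thesis by (simp add: pcg_def)
next
  case (Suc m)
  have "g (Suc m) \<bullet> p m = 0"
    using assms Suc by (intro exact_linesearch_orthogonal[of H c x]) (auto simp: pcg_def)
  moreover have "p (Suc m) = - (matrix_inv M *v g (Suc m))
      + ((g (Suc m) \<bullet> (matrix_inv M *v g (Suc m))) / (g m \<bullet> (matrix_inv M *v g m))) *\<^sub>R p m"
    using assms Suc unfolding pcg_def by blast
  ultimately show ?thesis
    unfolding Suc by (simp add: inner_diff_right inner_add_right)
qed

theorem proposition6p1:
  fixes H M A :: "real^'n^'n" and c :: "real^'n"
    and x g p xPCG gPCG pPCG :: "nat \<Rightarrow> real^'n"
    and \<delta> :: "nat \<Rightarrow> real" and k :: nat
  assumes H_sym: "transpose H = H" and H_pos: "pos_def H"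
    and M_sym: "transpose M = M" and M_pos: "pos_def M"
    and run: "exact_linesearch H c x g p"
    and run_PCG: "pcg M H c xPCG gPCG pPCG"
    and same_start: "xPCG 0 = x 0"
    and k_ge_1: "1 \<le> k"
    and not_terminated: "\<forall>i\<le>k. g i \<noteq> 0"
    and parallel: "\<forall>i<k. \<delta> i \<noteq> 0 \<and> p i = \<delta> i *\<^sub>R pPCG i"
    and A_eq: "A = mat 1 - (1 / (g (k - 1) \<bullet> p (k - 1))) *\<^sub>R outer (p (k - 1)) (g k)"
  shows "invertible A
    \<and> matrix_inv A = mat 1 + (1 / (g (k - 1) \<bullet> p (k - 1))) *\<^sub>R outer (p (k - 1)) (g k)
    \<and> (M ** A) *v pPCG k = - g k
    \<and> (\<forall>B :: real^'n^'n. invertible B \<and> B *v p k = - g k \<longrightarrow>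
         (\<forall>d :: real. d \<noteq> 0 \<longrightarrow>
            (p k = d *\<^sub>R pPCG k \<longleftrightarrow>
               (B ** matrix_inv A ** matrix_inv M) *v g k = (1 / d) *\<^sub>R g k)
          \<and> (p k = d *\<^sub>R pPCG k \<longleftrightarrow>
               (\<exists>W :: real^'n^'n. invertible W \<and> B = transpose A ** W ** A
                  \<and> (W ** matrix_inv M) *v g k = (1 / d) *\<^sub>R g k))))
    \<and> (\<forall>B W :: real^'n^'n. B = transpose A ** W ** A \<longrightarrow> (pos_def B \<longleftrightarrow> pos_def W))"
proof -
  obtain m where k: "k = Suc m" using k_ge_1 by (cases k) auto
  define q where "q = pPCG m"
  define N where "N = matrix_inv M"
  define s where "s = g m \<bullet> p m"
  have run': "exact_linesearch H c xPCG gPCG pPCG" using run_PCG by (simp add: pcg_def)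
  have g_eq: "gPCG j = g j" if "j \<le> k" for j
    using exact_linesearch_gradients_eq[OF run run' same_start parallel _ that] not_terminated
    by simp
  have nz': "\<forall>i\<le>Suc m. gPCG i \<noteq> 0" using not_terminated g_eq k by simp
  have dm: "\<delta> m \<noteq> 0" and pm: "p m = \<delta> m *\<^sub>R q" using parallel k by (auto simp: q_def)
  have orth: "g k \<bullet> p m = 0"
    unfolding k by (rule exact_linesearch_orthogonal[OF H_pos run]) (use not_terminated k in simp)
  then have orth_q: "g k \<bullet> q = 0" using dm pm by simp
  have gq: "g m \<bullet> q = - (g m \<bullet> (N *v g m))"
    using pcg_gradient_inner_direction[OF H_pos run_PCG, of m] nz' g_eq[of m] k
    by (simp add: q_def N_def)
  have gamma: "g m \<bullet> (N *v g m) > 0"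
    using pos_def_matrix_inv[OF M_pos] not_terminated k by (simp add: pos_def_def N_def)
  \<comment> \<open>This ties the scalar in \<open>A\<close> to the denominator of the PCG
    coefficient. The factor \<open>\<delta> m\<close> cancels against the one in
    \<open>p m\<close>.\<close>
  have s: "s = - (\<delta> m * (g m \<bullet> (N *v g m)))" by (simp add: s_def pm gq)
  have A: "A = mat 1 - (1 / s) *\<^sub>R outer (p m) (g k)" using A_eq k by (simp add: s_def)
  have A_inv: "invertible A" and A_inv_eq: "matrix_inv A = mat 1 + (1 / s) *\<^sub>R outer (p m) (g k)"
    unfolding A using inverse_id_minus_outer[OF orth] by auto
  have AT: "transpose A = mat 1 - (1 / s) *\<^sub>R outer (g k) (p m)"
    by (simp add: A vec_eq_iff transpose_def outer_def mat_def)
  have ATg: "transpose A *v g k = g k"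
    by (simp del: transpose_matrix_vector add: AT id_minus_outer_mult_vec orth inner_commute)
  have AT_inv: "invertible (transpose A)" using A_inv by (rule transpose_invertible)
  have pk: "pPCG k = - (N *v g k) + ((g k \<bullet> (N *v g k)) / (g m \<bullet> (N *v g m))) *\<^sub>R q"
    using run_PCG nz' g_eq[of m] g_eq[of k] unfolding pcg_def k N_def q_def by simp
  \<comment> \<open>By \<open>orth_q\<close>, the product of \<open>g k\<close> with
    \<open>pPCG k\<close> is \<open>- (g k \<bullet> (N *v g k))\<close>. With \<open>s\<close> and
    \<open>pm\<close>, the rank-one correction is then exactly the PCG multiple of \<open>q\<close>,
    and subtracting it leaves the preconditioned gradient term.\<close>
  have Apk: "A *v pPCG k = - (N *v g k)"
    unfolding A id_minus_outer_mult_vec pk using dm gamma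
    by (simp add: inner_diff_right orth_q s pm)
  have MApk: "(M ** A) *v pPCG k = - g k"
    using matrix_inv_vec_cancel(1)[OF pos_def_imp_invertible[OF M_pos], of "g k"]
    by (simp add: Apk N_def matrix_vector_mult_minus_right flip: matrix_vector_mul_assoc)
  have pk_eq: "matrix_inv A *v (N *v g k) = - pPCG k"
    using matrix_inv_vec_cancel(2)[OF A_inv, of "- pPCG k"]
    by (simp add: Apk matrix_vector_mult_minus_right)
  \<comment> \<open>Since \<open>B\<close> is injective, the two directions may be compared after
    applying \<open>B\<close>; \<open>pk_eq\<close> then rewrites \<open>- pPCG k\<close> through
    the inverse of \<open>A\<close>.\<close>
  have eigen_iff: "p k = d *\<^sub>R pPCG k \<longleftrightarrow> (B ** matrix_inv A ** N) *v g k = (1 / d) *\<^sub>R g k"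
    if B: "invertible B" "B *v p k = - g k" and d: "d \<noteq> 0" for B d
  proof -
    have "p k = d *\<^sub>R pPCG k \<longleftrightarrow> B *v p k = B *v (d *\<^sub>R pPCG k)"
      using matrix_inv_vec_cancel(2)[OF B(1)] by metis
    also have "\<dots> \<longleftrightarrow> - g k = d *\<^sub>R (B *v pPCG k)"
      by (simp add: B matrix_vector_mult_scaleR)
    also have "\<dots> \<longleftrightarrow> - (B *v pPCG k) = (1 / d) *\<^sub>R g k"
    proof -
      have "- a = d * b \<longleftrightarrow> - b = (1 / d) * a" for a b :: real
        using d by (auto simp: field_simps)
      then show ?thesis by (simp add: vec_eq_iff)
    qed
    finally show ?thesis
      by (simp add: pk_eq matrix_vector_mult_minus_right flip: matrix_vector_mul_assoc)
  qed
  have factor_iff: "(B ** matrix_inv A ** N) *v g k = e *\<^sub>R g k \<longleftrightarrow>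
      (\<exists>W. invertible W \<and> B = transpose A ** W ** A \<and> (W ** N) *v g k = e *\<^sub>R g k)"
    if B: "invertible B" for B e
  proof
    assume eq: "(B ** matrix_inv A ** N) *v g k = e *\<^sub>R g k"
    \<comment> \<open>The factorization \<open>B = transpose A ** W ** A\<close> forces this
      choice.\<close>
    define W where "W = matrix_inv (transpose A) ** B ** matrix_inv A"
    have "invertible W"
      unfolding W_def using A_inv AT_inv B by (intro invertible_mult) 
        (auto intro: matrix_inv_eqI(1) matrix_inv_mult(2))
    moreover have "B = transpose A ** W ** A"
      by (simp del: transpose_matrix_vector
          add: matrix_eq W_def matrix_inv_vec_cancel A_inv AT_inv flip: matrix_vector_mul_assoc)
    moreover have "(W ** N) *v g k = e *\<^sub>R g k"
    proof -
      have "(W ** N) *v g k = matrix_inv (transpose A) *v (e *\<^sub>R g k)"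
        unfolding eq[symmetric] by (simp add: W_def del: transpose_matrix_vector flip: matrix_vector_mul_assoc)
      \<comment> \<open>As \<open>transpose A\<close> fixes \<open>g k\<close>, so does its
        inverse.\<close>
      also have "\<dots> = e *\<^sub>R g k"
        using matrix_inv_vec_cancel(2)[OF AT_inv, of "g k"]
        by (simp del: transpose_matrix_vector add: ATg matrix_vector_mult_scaleR)
      finally show ?thesis .
    qed
    ultimately show "\<exists>W. invertible W \<and> B = transpose A ** W ** A \<and> (W ** N) *v g k = e *\<^sub>R g k"
      by blast
  next
    assume "\<exists>W. invertible W \<and> B = transpose A ** W ** A \<and> (W ** N) *v g k = e *\<^sub>R g k"
    then obtain W where W: "B = transpose A ** W ** A" "W *v (N *v g k) = e *\<^sub>R g k"
      by (auto simp: matrix_vector_mul_assoc)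
    \<comment> \<open>Here \<open>A\<close> cancels its inverse, and \<open>transpose A\<close> acts
      only on a multiple of \<open>g k\<close>, which it fixes.\<close>
    then show "(B ** matrix_inv A ** N) *v g k = e *\<^sub>R g k"
      by (simp del: transpose_matrix_vector add: matrix_inv_vec_cancel A_inv ATg matrix_vector_mult_scaleR
          flip: matrix_vector_mul_assoc)
  qed
  show ?thesis
    using A_inv A_inv_eq MApk eigen_iff factor_iff pos_def_congruence[OF A_inv]
    by (simp add: k s_def N_def)
qed

end
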